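(* Let $A$ be a finite set with at least two elements. For every clone $C$ on $A$, the following five conditions are equivalent: (i) $C$ has Property (SDC); (ii) $\langle C^\circ\rangle_{\nexists}=\operatorname{Inv}(C^{\ast})$; (iii) $\langle C^\circ\rangle_{\nexists}=\langle C^\circ\rangle_{\exists}$; (iv) every primitive positive formula over $C^{\circ}$ is equivalent to a quantifier-free primitive positive formula over $C^\circ$; (v) $\langle C^\circ\rangle_{\nexists}$ is a relational clone.
   Context: An operation on $A$ is a map $f\colon A^n\to A$, where the arity $n$ is a positive integer; $\mathcal{O}_A$ is the set of all operations on $A$, and $F^{(n)}$ is the set of $n$-ary members of $F\subseteq\mathcal{O}_A$. A clone on $A$ is a set $C\subseteq\mathcal{O}_A$ that contains all projections and is closed under composition. Operations $f\in\mathcal{O}_A^{(n)}$ and $g\in\mathcal{O}_A^{(m)}$ commute if $f(g(a_{11},\dots,a_{1m}),\dots,g(a_{n1},\dots,a_{nm}))=g(f(a_{11},\dots,a_{n1}),\dots,f(a_{1m},\dots,a_{nm}))$ for all $a_{ij}\in A$. The centralizer of $F\subseteq\mathcal{O}_A$ is $F^{\ast}=\{g\in\mathcal{O}_A : g \text{ commutes with every } f\in F\}$. A set $T\subseteq A^n$ is closed under a set $D$ of operations if for all $m\in\mathbb{N}$, $\mathbf{t}^{(1)},\dots,\mathbf{t}^{(m)}\in T$ and $f\in D^{(m)}$, the tuple obtained by applying $f$ componentwise to $\mathbf{t}^{(1)},\dots,\mathbf{t}^{(m)}$ is in $T$. A system of $C$-equations is a finite set $\mathcal{E}=\{(f_1,g_1),\dots,(f_t,g_t)\}$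 with $f_i,g_i\in C^{(n)}$ (all of the same arity $n$), and $\operatorname{Sol}(\mathcal{E})=\{\mathbf{a}\in A^n : f_i(\mathbf{a})=g_i(\mathbf{a}) \text{ for } i=1,\dots,t\}$; $\operatorname{Sol}(f,g)$ is the solution set of the single equation $(f,g)$. The clone $C$ has Property (SDC) if for all $n\in\mathbb{N}$ and all $T\subseteq A^n$ the following are equivalent: (a) there exists a system $\mathcal{E}$ of $C$-equations such that $T=\operatorname{Sol}(\mathcal{E})$; (b) the set $T$ is closed under $C^{\ast}$. $C^{\circ}=\{\operatorname{Sol}(f,g) : n\in\mathbb{N},\ f,g\in C^{(n)}\}$. An $h$-ary relation on $A$ ($h$ a positive integer) is a subset of $A^h$. For $F\subseteq\mathcal{O}_A$, $\operatorname{Inv}(F)$ is the set of all relations on $A$ (of all arities) that are closed under $F$. For a set $R$ of relations on $A$, a primitive positive formula over $R$ is a formula $\Phi(x_1,\dots,x_n)=\exists y_1\cdots\exists y_m\bigwedge_{j=1}^{t}\rho_j(z^{(j)}_1,\dots,z^{(j)}_{r_j})$, where $\rho_j\in R$ is $r_j$-ary and each $z_i^{(j)}$ is a variable from $\{x_1,\dots,x_n,y_1,\dots,y_m\}$ (quantifiers range over $A$); it is quantifier-free if no quantifiers occur ($m=0$). It defines the relation $\{(a_1,\dots,a_n)\in A^n : \Phi(a_1,\dots,a_n)\text{ is true}\}$. Two formulas in the same free variables are equivalent if they define the same relation. $\langle R\rangle_{\exists}$ (resp. $\langle R\rangle_{\nexists}$) is the set of all relations that can be defined by a primitive positive formula (resp.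 quantifier-free primitive positive formula) over $R\cup\{=\}$. A relational clone is a set $R$ of relations on $A$ that contains the equality relation and is closed under primitive positive definability.
   Formalization: Property (SDC) is required only for nonempty T, and (ii) is stated up to the empty relation; literally, the clone of all projections satisfies (iii)–(v) but not (i) or (ii), as the empty set is closed under C* but is not a solution set. *)

theory Defs
  imports Main "HOL-Library.FuncSet"
begin

text \<open>The base set \<open>A\<close> is the universe of a type \<open>'a\<close>, and \<open>A\<^sup>n\<close> is the set of lists of length \<open>n\<close>.\<close>

definition tuples :: "nat \<Rightarrow> 'a list set" where
  "tuples n = {xs. length xs = n}"


text \<open>
  An \<open>n\<close>-ary operation is a pair \<open>(n, f)\<close>. The function \<open>f\<close> is \<open>undefined\<close> outside \<open>A\<^sup>n\<close>, so that
  distinct pairs are distinct operations.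
\<close>

type_synonym 'a operation = "nat \<times> ('a list \<Rightarrow> 'a)"

definition operations :: "'a operation set" where
  "operations = {(n, f). n > 0 \<and> f \<in> extensional (tuples n)}"

definition nary :: "'a operation set \<Rightarrow> nat \<Rightarrow> ('a list \<Rightarrow> 'a) set" where
  "nary F n = {f. (n, f) \<in> F}"

definition proj :: "nat \<Rightarrow> nat \<Rightarrow> 'a list \<Rightarrow> 'a" where
  "proj n i = (\<lambda>xs \<in> tuples n. xs ! i)"

definition compose_op :: "nat \<Rightarrow> ('a list \<Rightarrow> 'a) \<Rightarrow> ('a list \<Rightarrow> 'a) list \<Rightarrow> 'a list \<Rightarrow> 'a" where
  "compose_op m f gs = (\<lambda>xs \<in> tuples m. f (map (\<lambda>g. g xs) gs))"

definition clone :: "'a operation set \<Rightarrow> bool" where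
  "clone C \<longleftrightarrow>
     C \<subseteq> operations \<and>
     (\<forall>n>0. \<forall>i<n. proj n i \<in> nary C n) \<and>
     (\<forall>n m. \<forall>f \<in> nary C n. \<forall>gs. length gs = n \<and> set gs \<subseteq> nary C m
        \<longrightarrow> compose_op m f gs \<in> nary C m)"

definition commutes :: "'a operation \<Rightarrow> 'a operation \<Rightarrow> bool" where
  "commutes = (\<lambda>(n, f) (m, g). \<forall>a :: nat \<Rightarrow> nat \<Rightarrow> 'a.
     f (map (\<lambda>i. g (map (\<lambda>j. a i j) [0..<m])) [0..<n]) =
     g (map (\<lambda>j. f (map (\<lambda>i. a i j) [0..<n])) [0..<m]))"

definition centralizer :: "'a operation set \<Rightarrow> 'a operation set" where
  "centralizer F = {g \<in> operations. \<forall>f \<in> F. commutes f g}"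

definition closed_under :: "nat \<Rightarrow> 'a list set \<Rightarrow> 'a operation set \<Rightarrow> bool" where
  "closed_under n T D \<longleftrightarrow>
     (\<forall>m. \<forall>f \<in> nary D m. \<forall>ts. length ts = m \<and> set ts \<subseteq> T
        \<longrightarrow> map (\<lambda>i. f (map (\<lambda>t. t ! i) ts)) [0..<n] \<in> T)"


definition equation_system ::
    "'a operation set \<Rightarrow> nat \<Rightarrow> (('a list \<Rightarrow> 'a) \<times> ('a list \<Rightarrow> 'a)) set \<Rightarrow> bool" where
  "equation_system C n E \<longleftrightarrow> finite E \<and> E \<subseteq> nary C n \<times> nary C n"

definition Sol :: "nat \<Rightarrow> (('a list \<Rightarrow> 'a) \<times> ('a list \<Rightarrow> 'a)) set \<Rightarrow> 'a list set" where
  "Sol n E = {a \<in> tuples n. \<forall>(f, g) \<in> E. f a = g a}"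

text \<open>
  Property (SDC), with \<open>T\<close> ranging over the nonempty sets. Operations have positive arity, so the
  empty set is closed under every set of operations; but it is not a solution set when the members
  of \<open>C\<close> have a common fixed point \<open>a\<close> (that is, \<open>f (a, \<dots>, a) = a\<close> for all \<open>f \<in> C\<close>). Admitting
  \<open>T = {}\<close> would make the property fail for all such \<open>C\<close>, for instance for the clone of projections
  and for every clone of idempotent operations.
\<close>

definition SDC :: "'a operation set \<Rightarrow> bool" where
  "SDC C \<longleftrightarrow>
     (\<forall>n>0. \<forall>T \<subseteq> tuples n. T \<noteq> {} \<longrightarrow>
        ((\<exists>E. equation_system C n E \<and> T = Sol n E) \<longleftrightarrow> closed_under n T (centralizer C)))"

definition single_sols :: "'a operation set \<Rightarrow> 'a list set set" where
  "single_sols C = {Sol n {(f, g)} | n f g. f \<in> nary C n \<and> g \<in> nary C n}"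


text \<open>
  An \<open>h\<close>-ary relation is just a subset of \<open>A\<^sup>h\<close>; in particular, the empty set is a relation of
  every arity, and \<open>{} \<in> Inv F\<close> for every \<open>F\<close>. By contrast \<open>{}\<close> is not definable from the solution
  sets over \<open>C\<close> when the members of \<open>C\<close> have a common fixed point, so relations over \<open>C\<close> should be
  compared with \<open>Inv\<close> only up to \<open>{}\<close>.
\<close>

definition relation_of_arity :: "nat \<Rightarrow> 'a list set \<Rightarrow> bool" where
  "relation_of_arity h \<rho> \<longleftrightarrow> h > 0 \<and> \<rho> \<subseteq> tuples h"

definition Inv :: "'a operation set \<Rightarrow> 'a list set set" where
  "Inv F = {\<rho>. \<exists>h. relation_of_arity h \<rho> \<and> closed_under h \<rho> F}"

definition eq_rel :: "'a list set" where
  "eq_rel = {[a, a] | a. True}"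

text \<open>
  \<open>PP n m [(\<rho>\<^sub>1, zs\<^sub>1), \<dots>, (\<rho>\<^sub>t, zs\<^sub>t)]\<close> is the formula
  \<open>\<exists>y\<^sub>0 \<dots> y\<^bsub>m-1\<^esub>. \<rho>\<^sub>1(zs\<^sub>1) \<and> \<dots> \<and> \<rho>\<^sub>t(zs\<^sub>t)\<close> in the free variables \<open>x\<^sub>0, \<dots>, x\<^bsub>n-1\<^esub>\<close>, where \<open>X i\<close>
  and \<open>Y j\<close> stand for \<open>x\<^sub>i\<close> and \<open>y\<^sub>j\<close>.
\<close>

datatype var = X nat | Y nat

datatype 'a pp_formula =
  PP (num_free: nat) (num_bound: nat) (atoms: "('a list set \<times> var list) list")

definition pp_over :: "'a list set set \<Rightarrow> 'a pp_formula \<Rightarrow> bool" where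
  "pp_over R \<Phi> \<longleftrightarrow>
     num_free \<Phi> > 0 \<and>
     (\<forall>(\<rho>, zs) \<in> set (atoms \<Phi>).
        \<rho> \<in> R \<and> relation_of_arity (length zs) \<rho> \<and>
        set zs \<subseteq> X ` {..<num_free \<Phi>} \<union> Y ` {..<num_bound \<Phi>})"

definition quantifier_free :: "'a pp_formula \<Rightarrow> bool" where
  "quantifier_free \<Phi> \<longleftrightarrow> num_bound \<Phi> = 0"

fun var_value :: "'a list \<Rightarrow> 'a list \<Rightarrow> var \<Rightarrow> 'a" where
  "var_value xs ys (X i) = xs ! i"
| "var_value xs ys (Y j) = ys ! j"

definition defined_rel :: "'a pp_formula \<Rightarrow> 'a list set" where
  "defined_rel \<Phi> =
     {xs \<in> tuples (num_free \<Phi>). \<exists>ys \<in> tuples (num_bound \<Phi>).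
        \<forall>(\<rho>, zs) \<in> set (atoms \<Phi>). map (var_value xs ys) zs \<in> \<rho>}"

definition pp_equivalent :: "'a pp_formula \<Rightarrow> 'a pp_formula \<Rightarrow> bool" where
  "pp_equivalent \<Phi> \<Psi> \<longleftrightarrow> num_free \<Phi> = num_free \<Psi> \<and> defined_rel \<Phi> = defined_rel \<Psi>"

definition pp_closure :: "'a list set set \<Rightarrow> 'a list set set" where
  "pp_closure R = {defined_rel \<Phi> | \<Phi>. pp_over (R \<union> {eq_rel}) \<Phi>}"

definition qf_closure :: "'a list set set \<Rightarrow> 'a list set set" where
  "qf_closure R = {defined_rel \<Phi> | \<Phi>. pp_over (R \<union> {eq_rel}) \<Phi> \<and> quantifier_free \<Phi>}"

definition relational_clone :: "'a list set set \<Rightarrow> bool" where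
  "relational_clone R \<longleftrightarrow>
     (\<forall>\<rho> \<in> R. \<exists>h. relation_of_arity h \<rho>) \<and>
     eq_rel \<in> R \<and>
     (\<forall>\<Phi>. pp_over R \<Phi> \<longrightarrow> defined_rel \<Phi> \<in> R)"

end

theory Submission
  imports Defs
begin

text \<open>
  Over a clone \<open>C\<close>, conjunctions of single equations are systems, and variables may be substituted
  into a system, so the quantifier-free definable relations are exactly the solution sets of
  systems, and the primitive positively definable ones are the projections of solution sets.
  The point is that every nonempty \<open>T\<close> closed under \<open>C\<^sup>*\<close> is such a projection. If
  \<open>T = {t\<^sub>1, \<dots>, t\<^sub>k}\<close>, a \<open>k\<close>-ary operation is a tuple indexed by \<open>A\<^sup>k\<close>; those in \<open>C\<^sup>*\<close> form the solution
  set of a system of \<open>C\<close>-equations (the commutation conditions), and \<open>T\<close> is obtained from this set by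
  projecting to the coordinates \<open>(t\<^sub>1(i), \<dots>, t\<^sub>k(i))\<close>.
  The empty relation is treated separately: an unsolvable system stays unsolvable when all its
  variables are identified, so if \<open>{}\<close> is definable at all, it is the solution set of a system in any
  given number of variables.
\<close>

section \<open>Solution sets of systems and substitution of variables\<close>

definition solution_sets :: "'a operation set \<Rightarrow> nat \<Rightarrow> 'a list set set" where
  "solution_sets C n = {Sol n E | E. equation_system C n E}"

text \<open>Preimages under \<open>select is\<close> are substitutions of variables, images are
  projections. Indices may repeat in both uses.\<close>

definition select :: "nat list \<Rightarrow> 'a list \<Rightarrow> 'a list" where
  "select is xs = map ((!) xs) is"

lemma finite_tuples: "finite (tuples n :: 'a::finite list set)"
  using finite_lists_length_eq[of "UNIV :: 'a set" n] by (simp add: tuples_def)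

lemma select_in_tuples: "select is xs \<in> tuples (length is)"
  by (simp add: select_def tuples_def)

lemma solution_sets_subset_tuples: "S \<in> solution_sets C n \<Longrightarrow> S \<subseteq> tuples n"
  by (auto simp: solution_sets_def Sol_def)

lemma tuples_in_solution_sets: "tuples n \<in> solution_sets C n"
  unfolding solution_sets_def equation_system_def Sol_def
  by (rule CollectI, rule exI[of _ "{}"]) auto

lemma Int_in_solution_sets:
  assumes "S \<in> solution_sets C n" "T \<in> solution_sets C n"
  shows "S \<inter> T \<in> solution_sets C n"
proof -
  obtain E F where "equation_system C n E" "S = Sol n E" "equation_system C n F" "T = Sol n F"
    using assms by (auto simp: solution_sets_def)
  then have "equation_system C n (E \<union> F)" "S \<inter> T = Sol n (E \<union> F)"
    by (auto simp: equation_system_def Sol_def)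
  then show ?thesis by (auto simp: solution_sets_def)
qed

lemma nary_pos: "clone C \<Longrightarrow> f \<in> nary C n \<Longrightarrow> n > 0"
  by (auto simp: clone_def nary_def operations_def)

lemma proj_in_clone: "clone C \<Longrightarrow> i < n \<Longrightarrow> proj n i \<in> nary C n"
  by (auto simp: clone_def)

lemma compose_op_in_clone:
  "clone C \<Longrightarrow> f \<in> nary C n \<Longrightarrow> length gs = n \<Longrightarrow> set gs \<subseteq> nary C m \<Longrightarrow> compose_op m f gs \<in> nary C m"
  by (auto simp: clone_def)

text \<open>Being extensional, an operation is determined by its values on the finite set
  \<open>tuples n\<close>. Finiteness lets the set of all equations valid at given tuples count as a
  system.\<close>

lemma finite_nary:
  fixes C :: "'a::finite operation set"
  assumes "clone C"
  shows "finite (nary C n)"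
proof (rule finite_subset)
  show "nary C n \<subseteq> tuples n \<rightarrow>\<^sub>E UNIV"
    using assms by (auto simp: clone_def nary_def operations_def PiE_def)
  show "finite ((tuples n :: 'a list set) \<rightarrow>\<^sub>E (UNIV :: 'a set))"
    by (intro finite_PiE finite_tuples) simp
qed

lemma compose_op_proj:
  "y \<in> tuples n \<Longrightarrow> compose_op n f (map (proj n) is) y = f (select is y)"
  by (simp add: compose_op_def proj_def select_def comp_def)

lemma compose_op_proj_in_clone:
  assumes "clone C" "f \<in> nary C (length is)" "set is \<subseteq> {..<n}"
  shows "compose_op n f (map (proj n) is) \<in> nary C n"
  using assms by (intro compose_op_in_clone) (auto intro: proj_in_clone)

text \<open>Composing both sides of every equation with the projections listed by \<open>is\<close>
  rewrites the system in \<open>n\<close> variables.\<close>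

lemma substitution_in_solution_sets:
  assumes C: "clone C" and S: "S \<in> solution_sets C (length is)" and "is": "set is \<subseteq> {..<n}"
  shows "{y \<in> tuples n. select is y \<in> S} \<in> solution_sets C n"
proof -
  define c where "c f = compose_op n f (map (proj n) is)" for f :: "'a list \<Rightarrow> 'a"
  obtain E where E: "equation_system C (length is) E" "S = Sol (length is) E"
    using S by (auto simp: solution_sets_def)
  define F where "F = map_prod c c ` E"
  have "equation_system C n F"
    using E(1) compose_op_proj_in_clone[OF C _ "is"]
    by (auto simp: equation_system_def F_def c_def)
  moreover have "{y \<in> tuples n. select is y \<in> S} = Sol n F"
    by (auto simp: E(2) F_def Sol_def c_def compose_op_proj select_in_tuples split: prod.splits)
  ultimately show ?thesis by (auto simp: solution_sets_def)
qed

text \<open>A nonempty set of tuples fixes its arity, but \<open>{}\<close> fits every arity. For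
  \<open>{}\<close>, all variables are identified with variable 0: a solution of the result would
  give a constant solution of the original system.\<close>

lemma solution_sets_change_arity:
  assumes "clone C" "S \<in> solution_sets C k" "S \<subseteq> tuples n" "n > 0"
  shows "S \<in> solution_sets C n"
proof (cases "S = {}")
  case True
  then show ?thesis
    using substitution_in_solution_sets[OF assms(1), of S "replicate k 0" n] assms(2,4)
    by (simp add: set_replicate_conv_if split: if_splits)
next
  case False
  then have "k = n"
    using solution_sets_subset_tuples[OF assms(2)] assms(3) by (auto simp: tuples_def)
  then show ?thesis using assms(2) by simp
qed

lemma Sol_in_single_sols: "equation_system C n E \<Longrightarrow> (f, g) \<in> E \<Longrightarrow> Sol n {(f, g)} \<in> single_sols C"
  by (auto simp: equation_system_def single_sols_def)

lemma single_sols_in_solution_sets: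
  assumes "clone C" "S \<in> single_sols C"
  shows "\<exists>n>0. S \<in> solution_sets C n"
proof -
  obtain n f g where "S = Sol n {(f, g)}" "f \<in> nary C n" "g \<in> nary C n"
    using assms(2) by (auto simp: single_sols_def)
  moreover from this have "equation_system C n {(f, g)}" "n > 0"
    using nary_pos[OF assms(1)] by (auto simp: equation_system_def)
  ultimately show ?thesis by (auto simp: solution_sets_def)
qed

text \<open>Hence formulas over \<open>single_sols C\<close> may use equality atoms, and adjoining
  \<open>eq_rel\<close> adds nothing.\<close>

lemma eq_rel_in_single_sols:
  assumes "clone C"
  shows "eq_rel \<in> single_sols C"
proof -
  have "eq_rel = Sol 2 {(proj 2 0, proj 2 1)}"
    by (auto simp: eq_rel_def Sol_def proj_def tuples_def length_Suc_conv numeral_2_eq_2)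
  moreover have "proj 2 0 \<in> nary C 2" "proj 2 1 \<in> nary C 2"
    using assms by (auto intro: proj_in_clone)
  ultimately show ?thesis unfolding single_sols_def by blast
qed

section \<open>Primitive positive formulas and projections of solution sets\<close>

text \<open>Positions in \<open>xs @ ys\<close>: the free variables come first, so quantifying the
  bound ones away amounts to \<open>take n\<close>.\<close>

fun var_index :: "nat \<Rightarrow> var \<Rightarrow> nat" where
  "var_index n (X i) = i"
| "var_index n (Y j) = n + j"

lemma map_var_value_eq_select:
  assumes "set zs \<subseteq> X ` {..<n} \<union> Y ` {..<m}" "length xs = n"
  shows "map (var_value xs ys) zs = select (map (var_index n) zs) (xs @ ys)"
  using assms by (auto simp: select_def nth_append)

text \<open>An atom is a substitution into a solution set, a conjunction an intersection. The arity
  \<open>k\<close> can differ from \<open>length zs\<close> only if \<open>\<rho>\<close> is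
  empty.\<close>

lemma atoms_in_solution_sets:
  assumes C: "clone C" and n: "n > 0"
    and "\<forall>(\<rho>, zs) \<in> set as. (\<exists>k. \<rho> \<in> solution_sets C k) \<and> relation_of_arity (length zs) \<rho> \<and>
          set zs \<subseteq> X ` {..<n} \<union> Y ` {..<m}"
  shows "{z \<in> tuples (n + m). \<forall>(\<rho>, zs) \<in> set as. select (map (var_index n) zs) z \<in> \<rho>}
          \<in> solution_sets C (n + m)"
  using assms(3)
proof (induction as)
  case Nil
  then show ?case using tuples_in_solution_sets by simp
next
  case (Cons a as)
  obtain \<rho> zs where a: "a = (\<rho>, zs)" by (cases a)
  let ?is = "map (var_index n) zs"
  have zs: "\<exists>k. \<rho> \<in> solution_sets C k" "relation_of_arity (length zs) \<rho>"
    "set zs \<subseteq> X ` {..<n} \<union> Y ` {..<m}"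
    using Cons.prems by (auto simp: a)
  then have "\<rho> \<in> solution_sets C (length ?is)"
    using solution_sets_change_arity[OF C] by (auto simp: relation_of_arity_def)
  moreover have "set ?is \<subseteq> {..<n + m}"
    using zs(3) by auto
  ultimately have "{z \<in> tuples (n + m). select ?is z \<in> \<rho>} \<in> solution_sets C (n + m)"
    by (rule substitution_in_solution_sets[OF C])
  then have "{z \<in> tuples (n + m). select ?is z \<in> \<rho>} \<inter>
      {z \<in> tuples (n + m). \<forall>(\<rho>, zs) \<in> set as. select (map (var_index n) zs) z \<in> \<rho>}
      \<in> solution_sets C (n + m)"
    using Cons by (intro Int_in_solution_sets) auto
  then show ?case
    by (rule back_subst[where P = "\<lambda>S. S \<in> _"]) (auto simp: a)
qed

text \<open>The conjunction of the atoms cuts out a solution set in all variables, and the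
  quantifiers project it to the free ones. \<open>R\<close> is general so as to cover
  \<open>single_sols C\<close>, with or without \<open>eq_rel\<close>, and its quantifier-free
  closure.\<close>

lemma defined_rel_projection:
  assumes C: "clone C" and \<Phi>: "pp_over R \<Phi>" and R: "\<And>\<rho>. \<rho> \<in> R \<Longrightarrow> \<exists>k. \<rho> \<in> solution_sets C k"
  shows "\<exists>S \<in> solution_sets C (num_free \<Phi> + num_bound \<Phi>). defined_rel \<Phi> = take (num_free \<Phi>) ` S"
proof -
  obtain n m as where \<Phi>_eq: "\<Phi> = PP n m as" by (cases \<Phi>)
  have n: "n > 0" and as: "\<And>\<rho> zs. (\<rho>, zs) \<in> set as \<Longrightarrow>
      \<rho> \<in> R \<and> relation_of_arity (length zs) \<rho> \<and> set zs \<subseteq> X ` {..<n} \<union> Y ` {..<m}"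
    using \<Phi> by (auto simp: pp_over_def \<Phi>_eq)
  let ?S = "{z \<in> tuples (n + m). \<forall>(\<rho>, zs) \<in> set as. select (map (var_index n) zs) z \<in> \<rho>}"
  have S: "?S \<in> solution_sets C (n + m)"
    using as R by (intro atoms_in_solution_sets[OF C n]) blast
  have *: "(\<forall>(\<rho>, zs) \<in> set as. map (var_value xs ys) zs \<in> \<rho>) \<longleftrightarrow>
      (\<forall>(\<rho>, zs) \<in> set as. select (map (var_index n) zs) (xs @ ys) \<in> \<rho>)"
    if "length xs = n" for xs ys
    using map_var_value_eq_select[OF _ that] as by (auto split: prod.splits) metis+
  have "defined_rel \<Phi> = take n ` ?S"
  proof (intro set_eqI iffI)
    fix xs assume "xs \<in> defined_rel \<Phi>"
    then obtain ys where "length xs = n" "length ys = m"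
      "\<forall>(\<rho>, zs) \<in> set as. map (var_value xs ys) zs \<in> \<rho>"
      by (auto simp: defined_rel_def \<Phi>_eq tuples_def)
    then have "xs @ ys \<in> ?S" "take n (xs @ ys) = xs"
      by (simp_all add: * tuples_def)
    then show "xs \<in> take n ` ?S" by (metis (no_types, lifting) imageI)
  next
    fix xs assume "xs \<in> take n ` ?S"
    then obtain z where z: "z \<in> ?S" "xs = take n z" by blast
    then have "length xs = n" "length (drop n z) = m" "xs @ drop n z = z"
      by (auto simp: tuples_def)
    then show "xs \<in> defined_rel \<Phi>"
      using z(1) *[of xs "drop n z"]
      by (auto simp: defined_rel_def \<Phi>_eq tuples_def intro!: exI[of _ "drop n z"])
  qed
  then show ?thesis using S by (auto simp: \<Phi>_eq)
qed

lemma quantifier_free_formula_for_solution_set: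
  assumes n: "n > 0" and "S \<in> solution_sets C n"
  shows "\<exists>\<Phi>. pp_over (single_sols C) \<Phi> \<and> quantifier_free \<Phi> \<and> num_free \<Phi> = n \<and> defined_rel \<Phi> = S"
proof -
  obtain E where E: "equation_system C n E" "S = Sol n E"
    using assms by (auto simp: solution_sets_def)
  obtain es where es: "set es = E"
    using E(1) finite_list by (auto simp: equation_system_def)
  define \<Phi> where "\<Phi> = PP n 0 (map (\<lambda>e. (Sol n {e}, map X [0..<n])) es)"
  have xs: "map (var_value xs ys) (map X [0..<n]) = xs" if "xs \<in> tuples n" for xs ys :: "'a list"
    using that by (auto simp: tuples_def intro: nth_equalityI)
  have "pp_over (single_sols C) \<Phi>"
    using Sol_in_single_sols[OF E(1)] n
    by (auto simp: pp_over_def \<Phi>_def es relation_of_arity_def Sol_def)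
  moreover have "defined_rel \<Phi> = S"
    using xs by (auto simp: defined_rel_def \<Phi>_def es E(2) Sol_def tuples_def comp_def)
  ultimately show ?thesis
    by (auto simp: \<Phi>_def quantifier_free_def)
qed

lemma pp_formula_for_projection:
  assumes C: "clone C" and n: "length is > 0" and S: "S \<in> solution_sets C m" and "is": "set is \<subseteq> {..<m}"
  shows "\<exists>\<Phi>. pp_over (single_sols C) \<Phi> \<and> num_free \<Phi> = length is \<and> defined_rel \<Phi> = select is ` S"
proof -
  let ?n = "length is"
  have m: "m > 0" using n "is" by (cases "is") auto
  obtain E where E: "equation_system C m E" "S = Sol m E"
    using S by (auto simp: solution_sets_def)
  obtain es where es: "set es = E"
    using E(1) finite_list by (auto simp: equation_system_def)
  \<comment> \<open>The bound variables carry a solution of the system; the equality atoms pin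
    \<open>X i\<close> to its coordinate \<open>is ! i\<close>, so repetitions in \<open>is\<close>
    do no harm.\<close>
  define \<Phi> where "\<Phi> = PP ?n m (map (\<lambda>e. (Sol m {e}, map Y [0..<m])) es @
    map (\<lambda>i. (eq_rel, [X i, Y (is ! i)])) [0..<?n])"
  have ys: "map (var_value xs ys) (map Y [0..<m]) = ys" if "ys \<in> tuples m" for xs ys :: "'a list"
    using that by (auto simp: tuples_def intro: nth_equalityI)
  have "is ! i < m" if "i < ?n" for i
    using "is" that nth_mem by blast
  then have "pp_over (single_sols C) \<Phi>"
    using Sol_in_single_sols[OF E(1)] eq_rel_in_single_sols[OF C] n m
    by (auto simp: pp_over_def \<Phi>_def es relation_of_arity_def Sol_def eq_rel_def tuples_def)
  moreover have "xs \<in> defined_rel \<Phi> \<longleftrightarrow> xs \<in> select is ` S" for xs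
  proof -
    have "xs \<in> defined_rel \<Phi> \<longleftrightarrow> xs \<in> tuples ?n \<and>
        (\<exists>ys \<in> tuples m. (\<forall>e \<in> E. ys \<in> Sol m {e}) \<and> (\<forall>i < ?n. [xs ! i, ys ! (is ! i)] \<in> eq_rel))"
      unfolding defined_rel_def \<Phi>_def
      by (simp add: es ball_Un ys atLeast0LessThan lessThan_def del: map_map cong: bex_cong)
    also have "\<dots> \<longleftrightarrow> (\<exists>ys \<in> S. xs \<in> tuples ?n \<and> (\<forall>i < ?n. xs ! i = ys ! (is ! i)))"
      by (auto simp: E(2) Sol_def eq_rel_def)
    also have "\<dots> \<longleftrightarrow> xs \<in> select is ` S"
      by (auto simp: image_iff select_def tuples_def list_eq_iff_nth_eq)
    finally show ?thesis .
  qed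
  ultimately show ?thesis
    by (intro exI[of _ \<Phi>]) (auto simp: \<Phi>_def)
qed

section \<open>Closure under the centralizer\<close>

lemma closed_underD:
  "closed_under n T D \<Longrightarrow> d \<in> nary D (length ts) \<Longrightarrow> set ts \<subseteq> T \<Longrightarrow>
    map (\<lambda>i. d (map (\<lambda>t. t ! i) ts)) [0..<n] \<in> T"
  by (auto simp: closed_under_def)

lemma centralizer_commutes:
  assumes "d \<in> nary (centralizer C) m" "f \<in> nary C n"
  shows "f (map (\<lambda>i. d (map (a i) [0..<m])) [0..<n]) =
    d (map (\<lambda>j. f (map (\<lambda>i. a i j) [0..<n])) [0..<m])"
  using assms by (auto simp: nary_def centralizer_def commutes_def)

text \<open>Apply \<open>d\<close> from the centralizer to solutions \<open>ts\<close>. By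
  commutation, \<open>f\<close> at the result is \<open>d\<close> of the values of \<open>f\<close>
  at \<open>ts\<close>; for an equation \<open>(f, g)\<close> of the system these values agree with
  those of \<open>g\<close>.\<close>

lemma solution_set_closed_under_centralizer:
  assumes "S \<in> solution_sets C n"
  shows "closed_under n S (centralizer C)"
proof -
  obtain E where E: "equation_system C n E" "S = Sol n E"
    using assms by (auto simp: solution_sets_def)
  show ?thesis
    unfolding closed_under_def
  proof (intro allI ballI impI, elim conjE)
    fix m d ts
    assume d: "d \<in> nary (centralizer C) m" and ts: "length ts = m" "set ts \<subseteq> S"
    let ?w = "map (\<lambda>i. d (map (\<lambda>t. t ! i) ts)) [0..<n]"
    have apply_w: "f ?w = d (map f ts)" if f: "f \<in> nary C n" for f
    proof -
      have nth: "map (\<lambda>i. t ! i) [0..<n] = t" if "t \<in> set ts" for t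
        using that ts(2) map_nth[of t] by (auto simp: E(2) Sol_def tuples_def)
      have "?w = map (\<lambda>i. d (map (\<lambda>j. ts ! j ! i) [0..<m])) [0..<n]"
        using ts(1) by (intro map_cong refl arg_cong[of _ _ d]) (auto intro: nth_equalityI)
      then have "f ?w = f (map (\<lambda>i. d (map (\<lambda>j. ts ! j ! i) [0..<m])) [0..<n])"
        by (rule arg_cong)
      also have "\<dots> = d (map (\<lambda>j. f (map (\<lambda>i. ts ! j ! i) [0..<n])) [0..<m])"
        by (rule centralizer_commutes[OF d f])
      also have "map (\<lambda>j. f (map (\<lambda>i. ts ! j ! i) [0..<n])) [0..<m] = map f ts"
        using ts(1) by (auto simp: nth intro!: nth_equalityI)
      finally show ?thesis .
    qed
    have "f ?w = g ?w" if "(f, g) \<in> E" for f g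
    proof -
      have "map f ts = map g ts"
        using ts(2) that by (auto simp: E(2) Sol_def)
      moreover have "f \<in> nary C n" "g \<in> nary C n"
        using E(1) that by (auto simp: equation_system_def)
      ultimately show ?thesis by (simp only: apply_w)
    qed
    then show "?w \<in> S" by (auto simp: E(2) Sol_def tuples_def)
  qed
qed

text \<open>The given tuples are lifted to \<open>S\<close> and combined there by \<open>d\<close>;
  componentwise application of \<open>d\<close> commutes with the selection of coordinates.\<close>

lemma select_image_closed_under:
  assumes S: "closed_under m S D" and "is": "set is \<subseteq> {..<m}"
  shows "closed_under (length is) (select is ` S) D"
  unfolding closed_under_def
proof (intro allI ballI impI, elim conjE)
  fix k d ts
  assume d: "d \<in> nary D k" and ts: "length ts = k" "set ts \<subseteq> select is ` S"
  obtain ss where ss: "set ss \<subseteq> S" "ts = map (select is) ss"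
  proof -
    have "ts \<in> lists (select is ` S)" using ts(2) by auto
    then have "ts \<in> map (select is) ` lists S" by (simp add: lists_image)
    then show ?thesis using that by auto
  qed
  let ?w = "map (\<lambda>i. d (map (\<lambda>s. s ! i) ss)) [0..<m]"
  have "?w \<in> S"
    using closed_underD[OF S] d ts(1) ss by simp
  moreover have "map (\<lambda>i. d (map (\<lambda>t. t ! i) ts)) [0..<length is] = select is ?w"
  proof (rule nth_equalityI)
    fix i assume "i < length (map (\<lambda>i. d (map (\<lambda>t. t ! i) ts)) [0..<length is])"
    then have "i < length is" "is ! i < m"
      using "is" nth_mem by (auto simp: subset_iff)
    then show "map (\<lambda>i. d (map (\<lambda>t. t ! i) ts)) [0..<length is] ! i = select is ?w ! i"
      by (simp add: select_def ss(2) comp_def)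
  qed (simp add: select_def)
  ultimately show "map (\<lambda>i. d (map (\<lambda>t. t ! i) ts)) [0..<length is] \<in> select is ` S"
    by blast
qed

section \<open>Closed sets as projections of solution sets\<close>

lemma proj_in_centralizer:
  assumes "clone C" "j < k"
  shows "proj k j \<in> nary (centralizer C) k"
  using assms by (auto simp: nary_def centralizer_def operations_def commutes_def proj_def tuples_def)

text \<open>The entries of the list \<open>as\<close> index the coordinates: \<open>map d as\<close> is the graph of \<open>d\<close>.\<close>

lemma graph_of_centralizer_operation:
  fixes C :: "'a::finite operation set"
  assumes C: "clone C" and k: "k > 0" and as: "set as = tuples k" "distinct as"
  shows "{map d as | d. d \<in> nary (centralizer C) k} \<in> solution_sets C (length as)"
proof -
  define N where "N = length as"
  \<comment> \<open>\<open>pos\<close> inverts indexing into \<open>as\<close>: it turns an argument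
    into the coordinate that holds the value there.\<close>
  define pos where "pos a = (SOME i. i < N \<and> as ! i = a)" for a
  have pos: "pos a < N \<and> as ! pos a = a" if "a \<in> tuples k" for a
  proof -
    have "\<exists>i < N. as ! i = a" using that as(1) by (simp add: N_def flip: in_set_conv_nth)
    then show ?thesis unfolding pos_def by (rule someI_ex)
  qed
  have pos_nth: "pos (as ! i) = i" if "i < N" for i
    using that pos[of "as ! i"] as by (metis N_def nth_eq_iff_index_eq nth_mem)
  define D where "D = nary (centralizer C) k"
  \<comment> \<open>All equations valid at every graph are taken, so graphs are solutions trivially.
    The converse only needs the commutation conditions to be among them.\<close>
  define E where "E = {(u, v) \<in> nary C N \<times> nary C N. \<forall>d \<in> D. u (map d as) = v (map d as)}"
  have "finite E"
    by (rule finite_subset[of _ "nary C N \<times> nary C N"]) (auto simp: E_def finite_nary[OF C])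
  then have E: "equation_system C N E"
    by (auto simp: equation_system_def E_def)
  have "Sol N E = {map d as | d. d \<in> D}"
  proof (intro set_eqI iffI)
    fix y assume "y \<in> {map d as | d. d \<in> D}"
    then show "y \<in> Sol N E"
      by (auto simp: Sol_def E_def tuples_def N_def)
  next
    fix y assume y: "y \<in> Sol N E"
    then have y_tuples: "y \<in> tuples N" by (auto simp: Sol_def)
    \<comment> \<open>The solution is read back as an operation, restricted to
      \<open>tuples k\<close> because operations are extensional.\<close>
    define d where "d = (\<lambda>a \<in> tuples k. y ! pos a)"
    have d_apply: "d a = y ! pos a" if "a \<in> tuples k" for a
      using that by (simp add: d_def)
    have "commutes (p, f) (k, d)" if f: "(p, f) \<in> C" for p f
      unfolding commutes_def prod.case
    proof (rule allI)
      fix a :: "nat \<Rightarrow> nat \<Rightarrow> 'a"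
      let ?row = "\<lambda>i. map (a i) [0..<k]"
      let ?val = "map (\<lambda>j. f (map (\<lambda>i. a i j) [0..<p])) [0..<k]"
      let ?is = "map (\<lambda>i. pos (?row i)) [0..<p]"
      have t: "?row i \<in> tuples k" "?val \<in> tuples k" for i
        by (auto simp: tuples_def)
      \<comment> \<open>The commutation condition for \<open>f\<close> and the matrix
        \<open>a\<close>, as an equation between \<open>N\<close>-ary operations: at the graph of
        \<open>e\<close>, \<open>u\<close> gives \<open>f\<close> of the values of \<open>e\<close>
        at the rows, and \<open>v\<close> gives the value of \<open>e\<close> at
        \<open>?val\<close>.\<close>
      define u where "u = compose_op N f (map (proj N) ?is)"
      define v :: "'a list \<Rightarrow> 'a" where "v = proj N (pos ?val)"
      have u: "u z = f (map (\<lambda>i. z ! pos (?row i)) [0..<p])" and v: "v z = z ! pos ?val"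
        if "z \<in> tuples N" for z
        using that unfolding u_def v_def
        by (simp_all only: compose_op_proj) (simp_all add: select_def comp_def proj_def)
      have "f \<in> nary C (length ?is)" "set ?is \<subseteq> {..<N}"
        using f pos t(1) by (auto simp: nary_def)
      then have "u \<in> nary C N"
        unfolding u_def by (rule compose_op_proj_in_clone[OF C])
      moreover have "v \<in> nary C N"
        unfolding v_def using pos[OF t(2)] by (intro proj_in_clone[OF C]) simp
      moreover have "u (map e as) = v (map e as)" if e: "e \<in> D" for e
      proof -
        have "map e as \<in> tuples N" by (simp add: tuples_def N_def)
        moreover have "map e as ! pos b = e b" if "b \<in> tuples k" for b
          using pos[OF that] by (simp add: N_def)
        ultimately show ?thesis
          using centralizer_commutes[of e C k f p a] e f t by (simp add: u v D_def nary_def)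
      qed
      ultimately have "(u, v) \<in> E" by (auto simp: E_def)
      then have "u y = v y" using y by (auto simp: Sol_def)
      then show "f (map (\<lambda>i. d (?row i)) [0..<p]) = d ?val"
        using t y_tuples by (simp add: u v d_apply)
    qed
    then have "d \<in> D"
      using k by (auto simp: D_def nary_def centralizer_def operations_def d_def)
    moreover have "y = map d as"
    proof (rule nth_equalityI)
      show "length y = length (map d as)" using y_tuples by (simp add: tuples_def N_def)
      fix i assume "i < length y"
      then have i: "i < N" using y_tuples by (simp add: tuples_def)
      then have "as ! i \<in> tuples k" using as(1) N_def nth_mem by blast
      then show "y ! i = map d as ! i" using i pos_nth by (simp add: N_def d_apply)
    qed
    ultimately show "y \<in> {map d as | d. d \<in> D}" by blast
  qed
  then show ?thesis using E by (auto simp: solution_sets_def D_def N_def)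
qed

lemma closed_under_centralizer_projection:
  fixes C :: "'a::finite operation set"
  assumes C: "clone C" and T: "T \<subseteq> tuples n" "T \<noteq> {}" "closed_under n T (centralizer C)"
  shows "\<exists>N is. \<exists>S \<in> solution_sets C N. set is \<subseteq> {..<N} \<and> length is = n \<and> T = select is ` S"
proof -
  have "finite T" using T(1) finite_tuples finite_subset by blast
  then obtain ts where ts: "set ts = T" using finite_list by blast
  define k where "k = length ts"
  \<comment> \<open>Nonemptiness of \<open>T\<close> enters here: operations have positive
    arity.\<close>
  have k: "k > 0" using ts T(2) by (auto simp: k_def)
  obtain as :: "'a list list" where as: "set as = tuples k" "distinct as"
    using finite_distinct_list finite_tuples by metis
  define S where "S = {map d as | d. d \<in> nary (centralizer C) k}"
  have S: "S \<in> solution_sets C (length as)"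
    unfolding S_def by (rule graph_of_centralizer_operation[OF C k as])
  \<comment> \<open>The \<open>i\<close>-th entries of the tuples in \<open>ts\<close> form an
    argument in \<open>tuples k\<close>, and \<open>p i\<close> is its coordinate in a graph.
    Selecting these coordinates thus applies an operation componentwise to
    \<open>ts\<close>.\<close>
  have "\<forall>i. \<exists>p < length as. as ! p = map (\<lambda>t. t ! i) ts"
    using as(1) by (simp add: in_set_conv_nth[symmetric] tuples_def k_def flip: Bex_def)
  then obtain p where p: "\<And>i. p i < length as" "\<And>i. as ! p i = map (\<lambda>t. t ! i) ts"
    by metis
  define "is" where "is = map p [0..<n]"
  have sel: "select is (map d as) = map (\<lambda>i. d (map (\<lambda>t. t ! i) ts)) [0..<n]" for d :: "'a list \<Rightarrow> 'a"
    using p by (simp add: select_def is_def)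
  have "T = select is ` S"
  proof (intro set_eqI iffI)
    fix t assume "t \<in> T"
    then obtain j where j: "j < k" "t = ts ! j"
      using ts by (metis in_set_conv_nth k_def)
    have "length t = n" using \<open>t \<in> T\<close> T(1) by (auto simp: tuples_def)
    \<comment> \<open>The \<open>j\<close>-th projection, which lies in the centralizer, returns
      \<open>ts ! j\<close>.\<close>
    then have "t = select is (map (proj k j) as)"
      using j by (auto simp: sel proj_def tuples_def k_def intro!: nth_equalityI)
    then show "t \<in> select is ` S"
      using proj_in_centralizer[OF C j(1)] by (auto simp: S_def)
  next
    fix t assume "t \<in> select is ` S"
    then show "t \<in> T"
      using closed_underD[OF T(3)] ts by (auto simp: S_def sel k_def)
  qed
  moreover have "set is \<subseteq> {..<length as}" "length is = n"
    using p by (auto simp: is_def)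
  ultimately show ?thesis using S by blast
qed

section \<open>Property (SDC) and definable relations\<close>

lemma defined_rel_closed_under_centralizer:
  assumes "clone C" "pp_over R \<Phi>" "\<And>\<rho>. \<rho> \<in> R \<Longrightarrow> \<exists>k. \<rho> \<in> solution_sets C k"
  shows "closed_under (num_free \<Phi>) (defined_rel \<Phi>) (centralizer C)"
proof -
  let ?n = "num_free \<Phi>" and ?m = "num_bound \<Phi>"
  obtain S where S: "S \<in> solution_sets C (?n + ?m)" "defined_rel \<Phi> = take ?n ` S"
    using defined_rel_projection[OF assms] by auto
  have "take ?n z = select [0..<?n] z" if "z \<in> S" for z
    using that solution_sets_subset_tuples[OF S(1)]
    by (auto simp: select_def tuples_def intro!: nth_equalityI)
  then have "defined_rel \<Phi> = select [0..<?n] ` S"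
    using S(2) by auto
  then show ?thesis
    using select_image_closed_under[OF solution_set_closed_under_centralizer[OF S(1)],
        of "[0..<?n]"] by (simp add: subset_iff)
qed

text \<open>Property (SDC) is silent about \<open>{}\<close>. A projection is empty only if the
  projected set is, so the system behind the formula is already unsolvable, and its arity can be
  changed.\<close>

lemma empty_defined_rel_in_solution_sets:
  assumes "clone C" "pp_over R \<Phi>" "\<And>\<rho>. \<rho> \<in> R \<Longrightarrow> \<exists>k. \<rho> \<in> solution_sets C k" "defined_rel \<Phi> = {}"
  shows "{} \<in> solution_sets C (num_free \<Phi>)"
proof -
  have "{} \<in> solution_sets C (num_free \<Phi> + num_bound \<Phi>)"
    using defined_rel_projection[OF assms(1-3)] assms(4) by auto
  then show ?thesis
    using solution_sets_change_arity[OF assms(1)] assms(2) by (auto simp: pp_over_def)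
qed

text \<open>Without bound variables the projection to the free ones is the identity. This turns
  questions about the closure into questions about systems.\<close>

lemma qf_closure_single_sols:
  assumes C: "clone C"
  shows "qf_closure (single_sols C) = (\<Union>n \<in> {0<..}. solution_sets C n)"
proof (intro set_eqI iffI)
  fix T assume "T \<in> qf_closure (single_sols C)"
  then obtain \<Phi> where \<Phi>: "pp_over (single_sols C \<union> {eq_rel}) \<Phi>" "num_bound \<Phi> = 0" "T = defined_rel \<Phi>"
    by (auto simp: qf_closure_def quantifier_free_def)
  have R: "\<exists>k. \<rho> \<in> solution_sets C k" if "\<rho> \<in> single_sols C \<union> {eq_rel}" for \<rho>
    using that single_sols_in_solution_sets[OF C] eq_rel_in_single_sols[OF C] by auto
  obtain S where S: "S \<in> solution_sets C (num_free \<Phi>)" "T = take (num_free \<Phi>) ` S"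
    using defined_rel_projection[OF C \<Phi>(1) R] \<Phi>(2,3) by auto
  have "take (num_free \<Phi>) z = z" if "z \<in> S" for z
    using that solution_sets_subset_tuples[OF S(1)] by (auto simp: tuples_def)
  then have "T = S" using S(2) by auto
  then show "T \<in> (\<Union>n \<in> {0<..}. solution_sets C n)"
    using S(1) \<Phi>(1) by (auto simp: pp_over_def)
next
  fix T assume "T \<in> (\<Union>n \<in> {0<..}. solution_sets C n)"
  then obtain \<Phi> where "pp_over (single_sols C) \<Phi>" "quantifier_free \<Phi>" "T = defined_rel \<Phi>"
    using quantifier_free_formula_for_solution_set by blast
  then show "T \<in> qf_closure (single_sols C)"
    unfolding qf_closure_def pp_over_def by blast
qed

text \<open>Only this direction has content, since solution sets are always closed under the
  centralizer.\<close>

lemma SDC_iff: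
  "SDC C \<longleftrightarrow> (\<forall>n>0. \<forall>T \<subseteq> tuples n. T \<noteq> {} \<longrightarrow> closed_under n T (centralizer C) \<longrightarrow> T \<in> solution_sets C n)"
proof -
  have "(\<exists>E. equation_system C n E \<and> T = Sol n E) \<longleftrightarrow> T \<in> solution_sets C n" for n T
    by (auto simp: solution_sets_def)
  then show ?thesis
    unfolding SDC_def using solution_set_closed_under_centralizer by metis
qed

text \<open>Quantifier elimination: nonempty definable relations are closed under the centralizer,
  so (SDC) applies to them.\<close>

lemma SDC_defined_rel:
  assumes "SDC C" "clone C" "pp_over R \<Phi>" "\<And>\<rho>. \<rho> \<in> R \<Longrightarrow> \<exists>k. \<rho> \<in> solution_sets C k"
  shows "defined_rel \<Phi> \<in> solution_sets C (num_free \<Phi>)"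
proof (cases "defined_rel \<Phi> = {}")
  case True
  then show ?thesis using empty_defined_rel_in_solution_sets[OF assms(2-4)] by simp
next
  case False
  moreover have "num_free \<Phi> > 0" "defined_rel \<Phi> \<subseteq> tuples (num_free \<Phi>)"
    using assms(3) by (auto simp: pp_over_def defined_rel_def)
  ultimately show ?thesis
    using assms(1) defined_rel_closed_under_centralizer[OF assms(2-4)] by (auto simp: SDC_iff)
qed

text \<open>A nonempty closed \<open>T\<close> is a projection of a solution set, hence definable.
  The assumption asks only for some arity \<open>k\<close> because the closures do not record
  arities.\<close>

lemma SDC_if_defined_rels:
  fixes C :: "'a::finite operation set"
  assumes C: "clone C"
    and def: "\<And>\<Phi>. pp_over (single_sols C) \<Phi> \<Longrightarrow> \<exists>k. defined_rel \<Phi> \<in> solution_sets C k"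
  shows "SDC C"
  unfolding SDC_iff
proof (intro allI impI)
  fix n and T :: "'a list set"
  assume n: "n > 0" and T: "T \<subseteq> tuples n" "T \<noteq> {}" "closed_under n T (centralizer C)"
  obtain N "is" S where S: "S \<in> solution_sets C N" "set is \<subseteq> {..<N}" "length is = n" "T = select is ` S"
    using closed_under_centralizer_projection[OF C T] by blast
  obtain \<Phi> where "pp_over (single_sols C) \<Phi>" "defined_rel \<Phi> = T"
    using pp_formula_for_projection[OF C _ S(1,2)] S(3,4) n by auto
  then obtain k where "T \<in> solution_sets C k" using def by auto
  then show "T \<in> solution_sets C n"
    using solution_sets_change_arity[OF C] T(1) n by blast
qed

section \<open>Equivalence of the five conditions\<close>

theorem theorem3p6:
  fixes C :: "'a::finite operation set"
  assumes "card (UNIV :: 'a set) \<ge> 2"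
    and "clone C"
  shows
    "(SDC C \<longleftrightarrow> qf_closure (single_sols C) - {{}} = Inv (centralizer C) - {{}}) \<and>
     (SDC C \<longleftrightarrow> qf_closure (single_sols C) = pp_closure (single_sols C)) \<and>
     (SDC C \<longleftrightarrow> (\<forall>\<Phi>. pp_over (single_sols C) \<Phi> \<longrightarrow>
        (\<exists>\<Psi>. pp_over (single_sols C) \<Psi> \<and> quantifier_free \<Psi> \<and> pp_equivalent \<Phi> \<Psi>))) \<and>
     (SDC C \<longleftrightarrow> relational_clone (qf_closure (single_sols C)))"
proof (intro conjI)
  note C = \<open>clone C\<close>
  let ?Q = "qf_closure (single_sols C)" and ?P = "pp_closure (single_sols C)"
  have Q: "?Q = (\<Union>n \<in> {0<..}. solution_sets C n)"
    by (rule qf_closure_single_sols[OF C])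
  have single_sols_Q: "single_sols C \<subseteq> ?Q"
    using single_sols_in_solution_sets[OF C] by (auto simp: Q)
  have R: "single_sols C \<union> {eq_rel} = single_sols C"
    using eq_rel_in_single_sols[OF C] by blast
  have Q_P: "?Q \<subseteq> ?P"
    by (auto simp: qf_closure_def pp_closure_def)
  \<comment> \<open>Formulas over \<open>?Q\<close> itself are covered, as condition (v)
    requires.\<close>
  have SDC_Q: "defined_rel \<Phi> \<in> ?Q" if "SDC C" "pp_over ?Q \<Phi>" for \<Phi>
    using SDC_defined_rel[OF that(1) C that(2)] that(2) by (auto simp: Q pp_over_def)
  have pp_Q: "pp_over ?Q \<Phi>" if "pp_over (single_sols C) \<Phi>" for \<Phi>
    using that single_sols_Q by (auto simp: pp_over_def)
  \<comment> \<open>The common way back to (SDC) from (iii), (iv) and (v).\<close>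
  have Q_SDC: "SDC C" if "\<And>\<Phi>. pp_over (single_sols C) \<Phi> \<Longrightarrow> defined_rel \<Phi> \<in> ?Q"
    using SDC_if_defined_rels[OF C] that by (auto simp: Q)

  show "SDC C \<longleftrightarrow> ?Q - {{}} = Inv (centralizer C) - {{}}"
  proof -
    \<comment> \<open>This inclusion always holds, so (ii) amounts to the reverse inclusion away
      from \<open>{}\<close>.\<close>
    have "?Q \<subseteq> Inv (centralizer C)"
      using solution_sets_subset_tuples solution_set_closed_under_centralizer
      by (fastforce simp: Q Inv_def relation_of_arity_def)
    moreover have "SDC C \<longleftrightarrow> Inv (centralizer C) - {{}} \<subseteq> ?Q"
    proof
      assume "SDC C"
      then show "Inv (centralizer C) - {{}} \<subseteq> ?Q"
        by (auto simp: SDC_iff Inv_def relation_of_arity_def Q)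
    next
      assume *: "Inv (centralizer C) - {{}} \<subseteq> ?Q"
      show "SDC C"
        unfolding SDC_iff
      proof (intro allI impI)
        fix n and T :: "'a list set"
        assume T: "n > 0" "T \<subseteq> tuples n" "T \<noteq> {}" "closed_under n T (centralizer C)"
        then have "T \<in> ?Q" using * by (auto simp: Inv_def relation_of_arity_def)
        \<comment> \<open>Membership in \<open>?Q\<close> yields a system of some arity
          only.\<close>
        then show "T \<in> solution_sets C n"
          using solution_sets_change_arity[OF C] T by (auto simp: Q)
      qed
    qed
    ultimately show ?thesis by blast
  qed

  show "SDC C \<longleftrightarrow> ?Q = ?P"
  proof
    assume "SDC C"
    then have "?P \<subseteq> ?Q" unfolding pp_closure_def R using SDC_Q pp_Q by blast
    then show "?Q = ?P" using Q_P by blast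
  next
    assume "?Q = ?P"
    then show "SDC C" unfolding pp_closure_def R by (intro Q_SDC) blast
  qed

  show "SDC C \<longleftrightarrow> (\<forall>\<Phi>. pp_over (single_sols C) \<Phi> \<longrightarrow>
      (\<exists>\<Psi>. pp_over (single_sols C) \<Psi> \<and> quantifier_free \<Psi> \<and> pp_equivalent \<Phi> \<Psi>))"
  proof (intro iffI allI impI)
    fix \<Phi> assume "SDC C" and \<Phi>: "pp_over (single_sols C) \<Phi>"
    have "defined_rel \<Phi> \<in> solution_sets C (num_free \<Phi>)"
      using SDC_defined_rel[OF \<open>SDC C\<close> C \<Phi>] single_sols_in_solution_sets[OF C] by blast
    moreover have "num_free \<Phi> > 0" using \<Phi> by (simp add: pp_over_def)
    ultimately show "\<exists>\<Psi>. pp_over (single_sols C) \<Psi> \<and> quantifier_free \<Psi> \<and> pp_equivalent \<Phi> \<Psi>"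
      using quantifier_free_formula_for_solution_set unfolding pp_equivalent_def by metis
  next
    assume *: "\<forall>\<Phi>. pp_over (single_sols C) \<Phi> \<longrightarrow>
      (\<exists>\<Psi>. pp_over (single_sols C) \<Psi> \<and> quantifier_free \<Psi> \<and> pp_equivalent \<Phi> \<Psi>)"
    show "SDC C"
      by (rule Q_SDC, unfold qf_closure_def R) (use * in \<open>auto simp: pp_equivalent_def\<close>)
  qed

  show "SDC C \<longleftrightarrow> relational_clone ?Q"
  proof
    assume "SDC C"
    have "\<exists>h. relation_of_arity h \<rho>" if "\<rho> \<in> ?Q" for \<rho>
      using that solution_sets_subset_tuples by (fastforce simp: Q relation_of_arity_def)
    then show "relational_clone ?Q"
      using SDC_Q[OF \<open>SDC C\<close>] single_sols_Q eq_rel_in_single_sols[OF C]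
      by (auto simp: relational_clone_def)
  next
    assume "relational_clone ?Q"
    then show "SDC C" using pp_Q by (intro Q_SDC) (auto simp: relational_clone_def)
  qed
qed

end
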